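(* Let $X=[x_1,x_2]$ and $Y=[y_1,y_2]$ be in $\mathbb{IR}$, let $XY$ be their classical interval product, and let $\varphi:\mathbb{IR}\to\mathcal{A}_4$ be the map defined in the context. (i) If $x_1x_2>0$ or $y_1y_2>0$, then $\varphi(XY)=\varphi(X)\cdot\varphi(Y)$. (ii) If $x_1x_2<0$ and $y_1y_2<0$, then $\varphi^{-1}(\varphi(XY))\subset\varphi^{-1}(\varphi(X)\cdot\varphi(Y))$ (inclusion of intervals, where $\varphi^{-1}(v)$ denotes the interval whose image under the injective map $\varphi$ is $v$).
   Context: $\mathbb{IR}$ is the set of closed bounded intervals $[x_1,x_2]$ of $\mathbb{R}$, $x_1\le x_2$. The classical product is $XY=[\min(x_1y_1,x_1y_2,x_2y_1,x_2y_2),\max(x_1y_1,x_1y_2,x_2y_1,x_2y_2)]$. $\mathcal{A}_4$ is the 4-dimensional real associative commutative algebra with basis $e_1,e_2,e_3,e_4$ and products $e_1e_1=e_1$, $e_1e_4=e_4e_1=e_4$, $e_4e_4=e_1$, $e_2e_2=e_2$, $e_2e_3=e_3e_2=e_3$, $e_3e_3=e_2$, all other products of basis vectors being $0$; in coordinates $x\cdot y=(x_1y_1+x_4y_4,\;x_2y_2+x_3y_3,\;x_3y_2+x_2y_3,\;x_4y_1+x_1y_4)$. The map $\varphi:\mathbb{IR}\to\mathcal{A}_4$ is, for $X=[x_1,x_2]$: $\varphi(X)=(x_1,x_2,0,0)$ if $x_1,x_2\ge0$; $\varphi(X)=(0,x_2,-x_1,0)$ if $x_1\le0$ and $x_2\ge0$;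 $\varphi(X)=(0,0,-x_1,-x_2)$ if $x_1,x_2\le0$. It is well defined and injective. *)

theory Defs
  imports Complex_Main "HOL-Library.Interval"
begin

text \<open>
  The real algebra \<open>A\<^sub>4\<close> in coordinates: \<open>Alg4 a b c d\<close> is
  \<open>a e\<^sub>1 + b e\<^sub>2 + c e\<^sub>3 + d e\<^sub>4\<close>.
  (The type \<open>real ^ 4\<close> is not used because its multiplication is already the componentwise one.)
\<close>

datatype alg4 = Alg4 (crd1: real) (crd2: real) (crd3: real) (crd4: real)

lemma alg4_eq_iff:
  "x = y \<longleftrightarrow> crd1 x = crd1 y \<and> crd2 x = crd2 y \<and> crd3 x = crd3 y \<and> crd4 x = crd4 y"
  by (auto intro: alg4.expand)

instantiation alg4 :: "{comm_ring_1, real_algebra_1}"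
begin

definition zero_alg4 where
  "0 = Alg4 0 0 0 0"

definition one_alg4 where
  "1 = Alg4 1 1 0 0"

definition plus_alg4 where
  "x + y = Alg4 (crd1 x + crd1 y) (crd2 x + crd2 y) (crd3 x + crd3 y) (crd4 x + crd4 y)"

definition uminus_alg4 where
  "- x = Alg4 (- crd1 x) (- crd2 x) (- crd3 x) (- crd4 x)"

definition minus_alg4 where
  "x - y = Alg4 (crd1 x - crd1 y) (crd2 x - crd2 y) (crd3 x - crd3 y) (crd4 x - crd4 y)"

definition scaleR_alg4 where
  "r *\<^sub>R x = Alg4 (r * crd1 x) (r * crd2 x) (r * crd3 x) (r * crd4 x)"

definition times_alg4 where
  "x * y = Alg4 (crd1 x * crd1 y + crd4 x * crd4 y)
                (crd2 x * crd2 y + crd3 x * crd3 y)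
                (crd3 x * crd2 y + crd2 x * crd3 y)
                (crd4 x * crd1 y + crd1 x * crd4 y)"

instance
  by standard
     (simp_all add: alg4_eq_iff zero_alg4_def one_alg4_def plus_alg4_def uminus_alg4_def
       minus_alg4_def scaleR_alg4_def times_alg4_def algebra_simps)

end

definition e1 :: alg4 where "e1 = Alg4 1 0 0 0"
definition e2 :: alg4 where "e2 = Alg4 0 1 0 0"
definition e3 :: alg4 where "e3 = Alg4 0 0 1 0"
definition e4 :: alg4 where "e4 = Alg4 0 0 0 1"

lemma Alg4_basis_expansion: "Alg4 a b c d = a *\<^sub>R e1 + b *\<^sub>R e2 + c *\<^sub>R e3 + d *\<^sub>R e4"
  by (simp add: e1_def e2_def e3_def e4_def plus_alg4_def scaleR_alg4_def)

lemma alg4_mult_table: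
  "e1 * e1 = e1" "e1 * e2 = 0"  "e1 * e3 = 0"  "e1 * e4 = e4"
  "e2 * e1 = 0"  "e2 * e2 = e2" "e2 * e3 = e3" "e2 * e4 = 0"
  "e3 * e1 = 0"  "e3 * e2 = e3" "e3 * e3 = e2" "e3 * e4 = 0"
  "e4 * e1 = e4" "e4 * e2 = 0"  "e4 * e3 = 0"  "e4 * e4 = e1"
  by (simp_all add: e1_def e2_def e3_def e4_def times_alg4_def zero_alg4_def)

definition phi :: "real interval \<Rightarrow> alg4" where
  "phi X =
    (if lower X \<ge> 0 \<and> upper X \<ge> 0 then Alg4 (lower X) (upper X) 0 0
     else if lower X \<le> 0 \<and> upper X \<ge> 0 then Alg4 0 (upper X) (- lower X) 0
     else Alg4 0 0 (- lower X) (- upper X))"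

text \<open>The three clauses agree where they overlap and cover all intervals.\<close>

lemma phi_nonneg:
  "lower X \<ge> 0 \<Longrightarrow> upper X \<ge> 0 \<Longrightarrow> phi X = Alg4 (lower X) (upper X) 0 0"
  by (simp add: phi_def)

lemma phi_mixed:
  "lower X \<le> 0 \<Longrightarrow> upper X \<ge> 0 \<Longrightarrow> phi X = Alg4 0 (upper X) (- lower X) 0"
  by (simp add: phi_def)

lemma phi_nonpos:
  "lower X \<le> 0 \<Longrightarrow> upper X \<le> 0 \<Longrightarrow> phi X = Alg4 0 0 (- lower X) (- upper X)"
  using lower_le_upper[of X] by (auto simp: phi_def simp del: lower_le_upper)

lemma phi_cases:
  fixes X :: "real interval"
  shows "lower X \<ge> 0 \<and> upper X \<ge> 0 \<or> lower X \<le> 0 \<and> upper X \<ge> 0 \<or> lower X \<le> 0 \<and> upper X \<le> 0"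
  using lower_le_upper[of X] by linarith

lemma inj_phi: "inj phi"
proof (rule injI)
  fix X Y assume "phi X = phi Y"
  then show "X = Y"
    using lower_le_upper[of X] lower_le_upper[of Y]
    by (auto simp: phi_def interval_eq_iff simp del: lower_le_upper split: if_splits)
qed

end

theory Submission
  imports Defs
begin

text \<open>
  The involution \<open>e3 + e4\<close> of the algebra swaps coordinates 1 and 4 and coordinates 2 and 3, and
  under \<open>phi\<close> multiplication by it is exactly reflection of intervals in the origin
  (\<open>phi_uminus\<close>). Reflection also commutes with the interval product, so for part (i) a factor
  that avoids 0 may be assumed positive, and by commutativity it may be taken to be the first
  one. For a nonnegative first factor the extreme endpoint products depend only on the signs of
  the endpoints of the second factor, one case per clause of \<open>phi\<close>, and they are, up to sign, the
  coordinates of the algebra product that this clause prescribes (\<open>phi_times_of_nonneg\<close>).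

  When both factors have 0 in their interior, each endpoint of the interval product is the
  smaller, or the larger, of two products of the same sign, whereas the algebra adds these two
  products. The sum is further from 0 than either summand, so the algebra product represents an
  interval that encloses the interval product.
\<close>

lemma phi_uminus: "phi (- X) = (e3 + e4) * phi X"
proof -
  have swap: "(e3 + e4) * Alg4 a b c d = Alg4 d c b a" for a b c d
    by (simp add: e3_def e4_def plus_alg4_def times_alg4_def)
  consider "lower X \<ge> 0" "upper X \<ge> 0" | "lower X \<le> 0" "upper X \<ge> 0" | "lower X \<le> 0" "upper X \<le> 0"
    using phi_cases by blast
  then show ?thesis
    by cases (simp_all add: swap phi_nonneg phi_mixed phi_nonpos)
qed

lemma e3_plus_e4_involution: "(e3 + e4) * (e3 + e4) = 1"
  by (simp add: e3_def e4_def plus_alg4_def times_alg4_def one_alg4_def)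

lemma interval_minus_mult_left:
  fixes X Y :: "real interval"
  shows "- X * Y = - (X * Y)"
proof -
  have "(\<exists>a b. z = a * b \<and> (\<exists>x. a = - x \<and> x \<in> A) \<and> b \<in> B)
      \<longleftrightarrow> (\<exists>w. z = - w \<and> (\<exists>x y. w = x * y \<and> x \<in> A \<and> y \<in> B))" for z and A B :: "real set"
    by (metis mult_minus_left)
  then show ?thesis
    by (simp only: interval_eq_set_of_iff set_of_uminus set_of_times mem_Collect_eq)
qed

text \<open>
  With \<open>X\<close> nonnegative, multiplication by an endpoint of \<open>X\<close> is monotone, so the extreme product
  uses the corresponding endpoint of \<open>Y\<close>; the sign of that endpoint then decides which endpoint
  of \<open>X\<close> is extreme.
\<close>

lemma lower_times_of_nonneg:
  fixes X Y :: "'a::linordered_idom interval"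
  assumes "0 \<le> lower X"
  shows "lower (X * Y) = (if 0 \<le> lower Y then lower X else upper X) * lower Y"
proof -
  define m where "m = (if 0 \<le> lower Y then lower X else upper X) * lower Y"
  have X: "0 \<le> upper X" "lower X \<le> upper X" and Y: "lower Y \<le> upper Y"
    using order_trans[OF assms lower_le_upper] by simp_all
  have near: "m \<le> lower X * lower Y" "m \<le> upper X * lower Y"
    using X by (auto simp: m_def intro: mult_right_mono mult_right_mono_neg)
  have "lower X * lower Y \<le> lower X * upper Y" "upper X * lower Y \<le> upper X * upper Y"
    by (intro mult_left_mono assms X Y)+
  with near have far: "m \<le> lower X * upper Y" "m \<le> upper X * upper Y"
    by (blast intro: order_trans)+
  have "Min {lower X * lower Y, lower X * upper Y, upper X * lower Y, upper X * upper Y} = m"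
  proof (rule Min_eqI)
    show "m \<in> {lower X * lower Y, lower X * upper Y, upper X * lower Y, upper X * upper Y}"
      by (simp add: m_def)
  qed (use near far in blast)+
  then show ?thesis
    by (simp only: lower_times m_def)
qed

lemma upper_times_of_nonneg:
  fixes X Y :: "'a::linordered_idom interval"
  assumes "0 \<le> lower X"
  shows "upper (X * Y) = (if 0 \<le> upper Y then upper X else lower X) * upper Y"
proof -
  define M where "M = (if 0 \<le> upper Y then upper X else lower X) * upper Y"
  have X: "0 \<le> upper X" "lower X \<le> upper X" and Y: "lower Y \<le> upper Y"
    using order_trans[OF assms lower_le_upper] by simp_all
  have near: "lower X * upper Y \<le> M" "upper X * upper Y \<le> M"
    using X by (auto simp: M_def intro: mult_right_mono mult_right_mono_neg)
  have "lower X * lower Y \<le> lower X * upper Y" "upper X * lower Y \<le> upper X * upper Y"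
    by (intro mult_left_mono assms X Y)+
  with near have far: "lower X * lower Y \<le> M" "upper X * lower Y \<le> M"
    by (blast intro: order_trans)+
  have "Max {lower X * lower Y, lower X * upper Y, upper X * lower Y, upper X * upper Y} = M"
  proof (rule Max_eqI)
    show "M \<in> {lower X * lower Y, lower X * upper Y, upper X * lower Y, upper X * upper Y}"
      by (simp add: M_def)
  qed (use near far in blast)+
  then show ?thesis
    by (simp only: upper_times M_def)
qed

text \<open>
  The sign class of \<open>X * Y\<close> is that of \<open>Y\<close>, so the clause of \<open>phi\<close> valid for \<open>Y\<close> also applies to
  \<open>X * Y\<close>. At an endpoint 0 of \<open>Y\<close> both candidate products vanish, and so the weak inequalities
  in the clauses cause no conflict.
\<close>

lemma phi_times_of_nonneg:
  assumes "0 \<le> lower X"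
  shows "phi (X * Y) = phi X * phi Y"
proof -
  have X: "0 \<le> upper X"
    using assms lower_le_upper[of X] by (rule order_trans)
  note endpoints = lower_times_of_nonneg[OF assms] upper_times_of_nonneg[OF assms]
  consider "lower Y \<ge> 0" "upper Y \<ge> 0" | "lower Y \<le> 0" "upper Y \<ge> 0" | "lower Y \<le> 0" "upper Y \<le> 0"
    using phi_cases by blast
  then show ?thesis
  proof cases
    case 1
    then show ?thesis using assms X
      by (simp add: phi_nonneg endpoints times_alg4_def)
  next
    case 2
    then show ?thesis using assms X
      by (auto simp: phi_nonneg phi_mixed endpoints times_alg4_def mult_nonneg_nonpos)
  next
    case 3
    then show ?thesis using assms X
      by (auto simp: phi_nonneg phi_nonpos endpoints times_alg4_def mult_nonneg_nonpos)
  qed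
qed

lemma phi_times_of_nonpos:
  assumes "upper X \<le> 0"
  shows "phi (X * Y) = phi X * phi Y"
proof -
  have "X * Y = - (- X * Y)"
    by (simp add: interval_minus_mult_left interval_eq_iff)
  then have "phi (X * Y) = phi (- (- X * Y))"
    by (rule arg_cong)
  also have "\<dots> = (e3 + e4) * (phi (- X) * phi Y)"
    using assms by (simp only: phi_uminus[of "- X * Y"]) (simp add: phi_times_of_nonneg)
  also have "\<dots> = ((e3 + e4) * (e3 + e4)) * (phi X * phi Y)"
    by (simp only: phi_uminus mult.assoc)
  finally show ?thesis
    by (simp add: e3_plus_e4_involution)
qed

lemma phi_times_of_definite:
  assumes "lower X * upper X > 0"
  shows "phi (X * Y) = phi X * phi Y"
  using assms phi_times_of_nonneg phi_times_of_nonpos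
  by (auto simp: zero_less_mult_iff)

text \<open>
  The algebra product of two images of mixed intervals stays in the plane spanned by \<open>e2\<close> and
  \<open>e3\<close>, with nonnegative coordinates there; such vectors are the images of mixed intervals.
\<close>

lemma phi_times_of_mixed:
  assumes "lower X \<le> 0" "0 \<le> upper X" "lower Y \<le> 0" "0 \<le> upper Y"
  obtains Z where "phi X * phi Y = phi Z" "set_of (X * Y) \<subseteq> set_of Z"
proof -
  let ?l = "lower X * upper Y + upper X * lower Y"
  let ?u = "lower X * lower Y + upper X * upper Y"
  have signs: "lower X * upper Y \<le> 0" "upper X * lower Y \<le> 0"
    "0 \<le> lower X * lower Y" "0 \<le> upper X * upper Y"
    using assms by (simp_all add: mult_nonpos_nonneg mult_nonneg_nonpos mult_nonpos_nonpos)
  then have "?l \<le> ?u"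
    by linarith
  then obtain Z where Z: "lower Z = ?l" "upper Z = ?u"
    using that[of "Interval (?l, ?u)"] by (simp add: lower.rep_eq upper.rep_eq Interval_inverse)
  have "phi X * phi Y = phi Z"
    using assms signs Z by (simp add: phi_mixed times_alg4_def)
  moreover have "lower Z \<le> lower (X * Y)" "upper (X * Y) \<le> upper Z"
    using signs by (simp_all add: Z lower_times upper_times)
  then have "set_of (X * Y) \<subseteq> set_of Z"
    by (auto simp: set_of_eq)
  ultimately show thesis
    by (rule that)
qed

theorem theorem18:
  fixes X Y :: "real interval"
  shows "(lower X * upper X > 0 \<or> lower Y * upper Y > 0 \<longrightarrow> phi (X * Y) = phi X * phi Y)
    \<and> (lower X * upper X < 0 \<and> lower Y * upper Y < 0 \<longrightarrow>
         phi X * phi Y \<in> range phi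
         \<and> set_of (inv phi (phi (X * Y))) \<subseteq> set_of (inv phi (phi X * phi Y)))"
proof (intro conjI[of "_ \<longrightarrow> _"] impI)
  assume "lower X * upper X > 0 \<or> lower Y * upper Y > 0"
  then show "phi (X * Y) = phi X * phi Y"
    using phi_times_of_definite[of X Y] phi_times_of_definite[of Y X]
    by (auto simp: interval_mul_commute[of X Y] mult.commute[of "phi X"])
next
  assume "lower X * upper X < 0 \<and> lower Y * upper Y < 0"
  then have "lower X \<le> 0" "0 \<le> upper X" "lower Y \<le> 0" "0 \<le> upper Y"
    using lower_le_upper[of X] lower_le_upper[of Y]
    by (auto simp: mult_less_0_iff simp del: lower_le_upper)
  then obtain Z where "phi X * phi Y = phi Z" "set_of (X * Y) \<subseteq> set_of Z"
    by (rule phi_times_of_mixed)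
  then show "phi X * phi Y \<in> range phi
      \<and> set_of (inv phi (phi (X * Y))) \<subseteq> set_of (inv phi (phi X * phi Y))"
    by (simp add: inv_f_f[OF inj_phi])
qed

end
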